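(* Let $\mathcal{H}$ be an $\alpha$-acyclic linear hypergraph with at least one edge. Then $\chi_I(\mathcal{H})\le \Delta(\mathcal{H})+r(\mathcal{H})-1$. In particular, if moreover $\mathcal{H}$ is $k$-uniform, then $\chi_I(\mathcal{H})=\Delta(\mathcal{H})+k-1$.
   Context: A (finite) hypergraph $\mathcal{H}=(X,S)$ consists of a vertex set $X$ and a set $S$ of non-empty subsets of $X$ (edges). The degree of $x\in X$ is $|\{s\in S: x\in s\}|$; $\Delta(\mathcal{H})$ is the maximum degree and $r(\mathcal{H})=\max\{|s|: s\in S\}$. $\mathcal{H}$ is linear if $|s\cap s'|\le 1$ for every two distinct edges $s,s'$, and $k$-uniform if $|s|=k$ for every edge $s$. GYO-reduction applies the following operations repeatedly until none can be applied: (i) eliminate a vertex lying in only one edge; (ii) eliminate an edge contained in another edge; (iii) eliminate an edge containing no vertex. $\mathcal{H}$ is $\alpha$-acyclic if GYO-reduction on it results in an empty hypergraph (no edges remain; vertices lying in no edge are disregarded). An incidence of $\mathcal{H}$ is a pair $(x,s)$ with $x\in X$, $s\in S$, $x\in s$. Two distinct incidences $(x,s)$ and $(x',s')$ are adjacent if $x=x'$, or $\{x,x'\}\subseteq s$, or $\{x,x'\}\subseteq s'$. A proper incidence $k$-coloring is a map from the set of incidences to $\{1,\dots,k\}$ giving distinct values to any two adjacent incidences; $\chi_I(\mathcal{H})$ is the minimum $k$ for which such a coloring exists. *)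

theory Defs
  imports Main
begin

definition hypergraph :: "'a set \<Rightarrow> 'a set set \<Rightarrow> bool" where
  "hypergraph X S \<longleftrightarrow> finite X \<and> S \<subseteq> Pow X \<and> {} \<notin> S"

definition degree :: "'a set set \<Rightarrow> 'a \<Rightarrow> nat" where
  "degree S x = card {s \<in> S. x \<in> s}"

(* Max {} is unspecified: max_degree is meaningful for X \<noteq> {}, rank for S \<noteq> {};
   both hold for a hypergraph with at least one edge. *)

definition max_degree :: "'a set \<Rightarrow> 'a set set \<Rightarrow> nat" where
  "max_degree X S = Max (degree S ` X)"

definition rank :: "'a set set \<Rightarrow> nat" where
  "rank S = Max (card ` S)"

definition linear_hypergraph :: "'a set set \<Rightarrow> bool" where
  "linear_hypergraph S \<longleftrightarrow> (\<forall>s\<in>S. \<forall>s'\<in>S. s \<noteq> s' \<longrightarrow> card (s \<inter> s') \<le> 1)"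

definition uniform :: "nat \<Rightarrow> 'a set set \<Rightarrow> bool" where
  "uniform k S \<longleftrightarrow> (\<forall>s\<in>S. card s = k)"

(* Only the edges are recorded, since vertices lying in no edge are disregarded.
   The intermediate edge sets may contain the empty edge.  Edges form a set, so an edge
   that becomes equal to another one after a vertex is eliminated merges with it; this
   has the same effect as then eliminating one of the two copies by edge_contained. *)

inductive gyo_step :: "'a set set \<Rightarrow> 'a set set \<Rightarrow> bool" where
  vertex_in_one_edge:
    "{t \<in> S. x \<in> t} = {s} \<Longrightarrow> gyo_step S (insert (s - {x}) (S - {s}))"
| edge_contained:
    "s \<in> S \<Longrightarrow> t \<in> S \<Longrightarrow> s \<noteq> t \<Longrightarrow> s \<subseteq> t \<Longrightarrow> gyo_step S (S - {s})"
| empty_edge: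
    "{} \<in> S \<Longrightarrow> gyo_step S (S - {{}})"

definition gyo_reduction :: "'a set set \<Rightarrow> 'a set set \<Rightarrow> bool" where
  "gyo_reduction S S' \<longleftrightarrow> gyo_step\<^sup>*\<^sup>* S S' \<and> (\<nexists>T. gyo_step S' T)"

definition alpha_acyclic :: "'a set set \<Rightarrow> bool" where
  "alpha_acyclic S \<longleftrightarrow> gyo_reduction S {}"

definition incidences :: "'a set \<Rightarrow> 'a set set \<Rightarrow> ('a \<times> 'a set) set" where
  "incidences X S = {(x, s). x \<in> X \<and> s \<in> S \<and> x \<in> s}"

definition adjacent :: "'a \<times> 'a set \<Rightarrow> 'a \<times> 'a set \<Rightarrow> bool" where
  "adjacent i j \<longleftrightarrow> i \<noteq> j \<and>
     (fst i = fst j \<or> {fst i, fst j} \<subseteq> snd i \<or> {fst i, fst j} \<subseteq> snd j)"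

definition proper_incidence_coloring ::
    "'a set \<Rightarrow> 'a set set \<Rightarrow> nat \<Rightarrow> ('a \<times> 'a set \<Rightarrow> nat) \<Rightarrow> bool" where
  "proper_incidence_coloring X S k c \<longleftrightarrow>
     c ` incidences X S \<subseteq> {1..k} \<and>
     (\<forall>i\<in>incidences X S. \<forall>j\<in>incidences X S. adjacent i j \<longrightarrow> c i \<noteq> c j)"

definition incidence_chromatic_number :: "'a set \<Rightarrow> 'a set set \<Rightarrow> nat" where
  "incidence_chromatic_number X S = (LEAST k. \<exists>c. proper_incidence_coloring X S k c)"

end

theory Submission
  imports Defs
begin

text \<open>
  Reading a GYO-reduction backwards rebuilds the hypergraph edge by edge so that each new edge
  meets the union of the earlier ones inside a single earlier edge (the running intersection
  property).  In a linear hypergraph two edges share at most one vertex, so each new edge \<open>s\<close> is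
  glued to the earlier ones at one vertex \<open>v\<close> at most.

  Such a gluing sequence can be coloured greedily if some colours are saved in advance.  At a vertex
  \<open>v\<close> there are two kinds of colours: those of the incidences \<open>(v, s)\<close>, which are pairwise adjacent,
  and those of the incidences \<open>(x, s)\<close> with \<open>v \<in> s\<close> and \<open>x \<noteq> v\<close>, which are adjacent to all of the
  first kind.  A colouring is proper exactly if at each vertex the first kind is repetition-free and
  disjoint from the second kind.  There are at most \<open>\<Delta>\<close> colours of the first kind; the invariant is
  that at each vertex there are at most \<open>r - 1\<close> of the second kind, that is, all edges at \<open>v\<close>
  share one palette of \<open>r - 1\<close> colours for their other vertices.  With \<open>\<Delta> + r - 1\<close> colours there is
  then always a free one for \<open>(v, s)\<close>, and the other vertices of \<open>s\<close> take theirs from the palette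
  of \<open>v\<close>.  At these vertices \<open>s\<close> is the only edge, so the invariant is trivial there
  (\<open>extend_palette_coloring\<close>).

  For the lower bound in the \<open>k\<close>-uniform case, fix a vertex \<open>v\<close> of maximum degree and an edge \<open>s\<close>
  containing it.  The \<open>\<Delta>\<close> incidences at \<open>v\<close> and the \<open>k - 1\<close> other incidences of \<open>s\<close> are pairwise
  adjacent.
\<close>

section \<open>Running intersection orders of acyclic hypergraphs\<close>

text \<open>The order in which the edges are inserted is left implicit in the derivation, so that
  induction on it is induction along the order.  The empty edge is allowed because it may appear
  during a GYO-reduction.\<close>

inductive running_intersection :: "'a set set \<Rightarrow> bool" where
  empty: "running_intersection {}"
| insert: "running_intersection S \<Longrightarrow> s \<notin> S \<Longrightarrow> S = {} \<or> (\<exists>t\<in>S. s \<inter> \<Union>S \<subseteq> t)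
    \<Longrightarrow> running_intersection (insert s S)"

lemma running_intersection_finite: "running_intersection S \<Longrightarrow> finite S"
  by (induction rule: running_intersection.induct) auto

text \<open>A vertex new to the whole hypergraph changes no intersection of two edges, so the enlarged
  edge can take the old place of \<open>u\<close> in the order.\<close>

lemma running_intersection_enlarge_edge:
  assumes "running_intersection S" "u \<in> S" "x \<notin> \<Union>S"
  shows "running_intersection (insert (insert x u) (S - {u}))"
  using assms
proof (induction rule: running_intersection.induct)
  case empty
  then show ?case by simp
next
  case (insert S s)
  show ?case
  proof (cases "u = s")
    case True
    have "running_intersection (insert (insert x s) S)"
      using insert.hyps insert.prems True by (intro running_intersection.insert) auto
    moreover have "insert s S - {s} = S" using insert.hyps by auto
    ultimately show ?thesis using True by simp
  next
    case False
    let ?S' = "insert (insert x u) (S - {u})"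
    have u: "u \<in> S" and x: "x \<notin> s" "x \<notin> \<Union>S" using insert.prems False by auto
    then obtain t where t: "t \<in> S" "s \<inter> \<Union>S \<subseteq> t" using insert.hyps by auto
    have meet: "s \<inter> \<Union>?S' \<subseteq> t" using t u x by auto
    have "\<exists>t'\<in>?S'. s \<inter> \<Union>?S' \<subseteq> t'"
    proof (cases "t = u")
      case True
      then have "s \<inter> \<Union>?S' \<subseteq> insert x u" using meet by blast
      then show ?thesis by blast
    next
      case False
      then show ?thesis using t meet by blast
    qed
    moreover have "running_intersection ?S'" using insert.IH u x by simp
    moreover have "s \<notin> ?S'" using insert.hyps x by auto
    ultimately have "running_intersection (insert s ?S')"
      by (rule running_intersection.insert[rotated 2, OF disjI2])
    moreover have "insert s ?S' = insert (insert x u) (insert s S - {u})" using False by auto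
    ultimately show ?thesis by simp
  qed
qed

text \<open>An edge contained in another one can be inserted last, as can the empty edge.  Restoring an
  eliminated vertex enlarges an edge, unless the diminished edge had merged with another one; then
  the restored edge is inserted last and meets the others inside its twin.\<close>

lemma gyo_step_running_intersection:
  assumes "gyo_step S T" "running_intersection T"
  shows "running_intersection S"
  using assms
proof (induction rule: gyo_step.induct)
  case (vertex_in_one_edge S x s)
  then have s: "s \<in> S" "x \<in> s" and only: "\<And>t. t \<in> S \<Longrightarrow> x \<in> t \<Longrightarrow> t = s" by blast+
  show ?case
  proof (cases "s - {x} \<in> S")
    case True
    have "insert (s - {x}) (S - {s}) = S - {s}" using True s by blast
    then have "running_intersection (S - {s})" using vertex_in_one_edge by simp
    moreover have "s \<inter> \<Union>(S - {s}) \<subseteq> s - {x}" using only by blast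
    moreover have "s - {x} \<in> S - {s}" using True s by blast
    ultimately have "running_intersection (insert s (S - {s}))"
      by (intro running_intersection.insert) auto
    then show ?thesis using s by (simp add: insert_absorb)
  next
    case False
    let ?T = "insert (s - {x}) (S - {s})"
    have "x \<notin> \<Union>?T" using only by blast
    then have "running_intersection (insert (insert x (s - {x})) (?T - {s - {x}}))"
      using vertex_in_one_edge by (intro running_intersection_enlarge_edge) auto
    moreover have "insert (insert x (s - {x})) (?T - {s - {x}}) = S"
      using False s by (auto simp: insert_absorb)
    ultimately show ?thesis by simp
  qed
next
  case (edge_contained s S t)
  then have "running_intersection (insert s (S - {s}))"
    by (intro running_intersection.insert) auto
  then show ?case using edge_contained by (simp add: insert_absorb)
next
  case (empty_edge S)
  then have "running_intersection (insert {} (S - {{}}))"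
    by (intro running_intersection.insert) auto
  then show ?case using empty_edge by (simp add: insert_absorb)
qed

lemma alpha_acyclic_running_intersection:
  assumes "alpha_acyclic S"
  shows "running_intersection S"
proof -
  have "gyo_step\<^sup>*\<^sup>* S {}" using assms by (simp add: alpha_acyclic_def gyo_reduction_def)
  then show ?thesis
    by (induction rule: converse_rtranclp_induct)
       (auto intro: running_intersection.empty gyo_step_running_intersection)
qed

section \<open>Colourings with a bounded palette at each vertex\<close>

definition own_colors :: "('a \<times> 'a set \<Rightarrow> nat) \<Rightarrow> 'a set set \<Rightarrow> 'a \<Rightarrow> nat set" where
  "own_colors c S v = (\<lambda>s. c (v, s)) ` {s \<in> S. v \<in> s}"

definition neighbour_colors :: "('a \<times> 'a set \<Rightarrow> nat) \<Rightarrow> 'a set set \<Rightarrow> 'a \<Rightarrow> nat set" where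
  "neighbour_colors c S v = (\<Union>s\<in>{s \<in> S. v \<in> s}. (\<lambda>x. c (x, s)) ` (s - {v}))"

text \<open>The first three conditions say that the colouring is proper.  The last one is the invariant
  that keeps colours free for later edges.\<close>

definition palette_coloring :: "nat set \<Rightarrow> nat \<Rightarrow> 'a set set \<Rightarrow> ('a \<times> 'a set \<Rightarrow> nat) \<Rightarrow> bool" where
  "palette_coloring C p S c \<longleftrightarrow>
     (\<forall>v. own_colors c S v \<subseteq> C \<and>
          inj_on (\<lambda>s. c (v, s)) {s \<in> S. v \<in> s} \<and>
          own_colors c S v \<inter> neighbour_colors c S v = {} \<and>
          card (neighbour_colors c S v) \<le> p)"

lemma palette_coloring_proper:
  assumes "palette_coloring {1..k} p S c"
  shows "proper_incidence_coloring X S k c"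
  unfolding proper_incidence_coloring_def
proof (intro conjI ballI impI)
  show "c ` incidences X S \<subseteq> {1..k}"
    using assms unfolding palette_coloring_def own_colors_def incidences_def by fast
next
  fix i j assume i: "i \<in> incidences X S" and j: "j \<in> incidences X S" and adj: "adjacent i j"
  obtain x s y t where ij: "i = (x, s)" "j = (y, t)" by fastforce
  have mem: "s \<in> S" "x \<in> s" "t \<in> S" "y \<in> t" using i j ij by (auto simp: incidences_def)
  have inj: "inj_on (\<lambda>s. c (v, s)) {s \<in> S. v \<in> s}"
    and disj: "own_colors c S v \<inter> neighbour_colors c S v = {}" for v
    using assms unfolding palette_coloring_def by blast+
  \<comment> \<open>At \<open>b\<close>, the colour of \<open>(a, u)\<close> is a neighbour colour, that of
    \<open>(b, w)\<close> an own colour.\<close>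
  have diff: "c (a, u) \<noteq> c (b, w)"
    if "u \<in> S" "a \<in> u" "b \<in> u" "w \<in> S" "b \<in> w" "a \<noteq> b" for a b u w
  proof -
    have "c (b, w) \<in> own_colors c S b" using that by (auto simp: own_colors_def)
    moreover have "c (a, u) \<in> neighbour_colors c S b"
      using that by (auto simp: neighbour_colors_def)
    ultimately show ?thesis using disj[of b] by (metis disjoint_iff)
  qed
  show "c i \<noteq> c j"
  proof (cases "x = y")
    case True
    then have "s \<noteq> t" using adj ij by (auto simp: adjacent_def)
    then show ?thesis using inj_onD[OF inj[of x], of s t] True mem ij by auto
  next
    case False
    then consider "y \<in> s" | "x \<in> t" using adj ij by (auto simp: adjacent_def)
    then show ?thesis
    proof cases
      case 1
      then show ?thesis using diff[of s x y t] mem False ij by simp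
    next
      case 2
      then show ?thesis using diff[of t y x s] mem False ij by auto
    qed
  qed
qed

text \<open>The colour \<open>a\<close> of the incidence \<open>(v, s)\<close> must avoid all colours seen at \<open>v\<close>, at most
  \<open>(D - 1) + p\<close> many.  The other incidences of \<open>s\<close> use a palette \<open>B\<close> of exactly \<open>p\<close> colours that
  contains the neighbour colours present at \<open>v\<close>; as \<open>v\<close> has at most \<open>D\<close> own colours, \<open>a\<close> included,
  there is room for \<open>B\<close> beside them.\<close>

lemma extend_palette_coloring:
  assumes col: "palette_coloring C p S c" and C: "finite C" "card C = D + p"
    and S: "finite S" "\<And>t. t \<in> S \<Longrightarrow> finite t"
    and s: "s \<notin> S" "finite s" "card s \<le> Suc p"
    and v: "v \<in> s" "s \<inter> \<Union>S \<subseteq> {v}"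
    and deg: "degree (insert s S) v \<le> D"
  shows "\<exists>c'. palette_coloring C p (insert s S) c'"
proof -
  let ?I = "own_colors c S v" and ?O = "neighbour_colors c S v"
  have sub: "own_colors c S w \<subseteq> C"
    and inj: "inj_on (\<lambda>t. c (w, t)) {t \<in> S. w \<in> t}"
    and disj: "own_colors c S w \<inter> neighbour_colors c S w = {}"
    and few: "card (neighbour_colors c S w) \<le> p" for w
    using col unfolding palette_coloring_def by blast+
  have OC: "?O \<subseteq> C" using sub unfolding neighbour_colors_def own_colors_def by fast
  have fin: "finite ?I" "finite ?O" using sub OC C by (auto intro: finite_subset)
  have "{t \<in> insert s S. v \<in> t} = insert s {t \<in> S. v \<in> t}" using v by blast
  then have "Suc (card {t \<in> S. v \<in> t}) \<le> D" using deg s S by (simp add: degree_def)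
  moreover have "card ?I \<le> card {t \<in> S. v \<in> t}"
    unfolding own_colors_def using S by (intro card_image_le) auto
  ultimately have cardI: "Suc (card ?I) \<le> D" by simp
  have "card (?I \<union> ?O) < card C"
    using card_Un_le[of ?I ?O] few[of v] cardI C by linarith
  then have "\<not> C \<subseteq> ?I \<union> ?O" using card_mono[of "?I \<union> ?O" C] fin by auto
  then obtain a where a: "a \<in> C" "a \<notin> ?I" "a \<notin> ?O" by blast
  have "card (C - insert a ?I) = card C - card (insert a ?I)"
    using a sub fin by (intro card_Diff_subset) auto
  then have "p \<le> card (C - insert a ?I)" using a fin cardI C by simp
  moreover have "?O \<subseteq> C - insert a ?I" using OC disj a by blast
  ultimately obtain B where B: "?O \<subseteq> B" "B \<subseteq> C - insert a ?I" "card B = p"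
    using exists_subset_between[of ?O p "C - insert a ?I"] few[of v] C by auto
  have finB: "finite B" using B C by (auto intro: finite_subset)
  have "card (s - {v}) \<le> card B" using s v B by simp
  then obtain g where g: "g ` (s - {v}) \<subseteq> B" "inj_on g (s - {v})"
    using card_le_inj[of "s - {v}" B] s finB by auto
  define f where "f = g(v := a)"
  have fv: "f v = a" and fB: "f ` (s - {v}) \<subseteq> B" using g by (auto simp: f_def)
  have finj: "inj_on f s"
  proof (rule inj_onI)
    fix x y assume xy: "x \<in> s" "y \<in> s" "f x = f y"
    have "a \<notin> g ` (s - {v})" using g B by blast
    then show "x = y" using xy inj_onD[OF g(2), of x y]
      by (auto simp: f_def split: if_splits)
  qed
  have fC: "f ` s \<subseteq> C"
  proof
    fix z assume "z \<in> f ` s"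
    then obtain y where "y \<in> s" "z = f y" by blast
    then show "z \<in> C" using fv fB a B by (cases "y = v") auto
  qed
  define c' where "c' = (\<lambda>(x, t). if t = s then f x else c (x, t))"
  have c'_new: "c' (x, s) = f x" for x by (simp add: c'_def)
  have c'_old: "c' (x, t) = c (x, t)" if "t \<in> S" for x t using that s by (auto simp: c'_def)
  have at_in: "{t \<in> insert s S. w \<in> t} = insert s {t \<in> S. w \<in> t}" if "w \<in> s" for w
    using that by blast
  have at_notin: "{t \<in> insert s S. w \<in> t} = {t \<in> S. w \<in> t}" if "w \<notin> s" for w
    using that by blast
  have own_old: "(\<lambda>t. c' (w, t)) ` {t \<in> S. w \<in> t} = own_colors c S w" for w
    using c'_old by (auto simp: own_colors_def)
  have nb_old: "(\<Union>t\<in>{t \<in> S. w \<in> t}. (\<lambda>x. c' (x, t)) ` (t - {w})) = neighbour_colors c S w" for w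
    using c'_old by (auto simp: neighbour_colors_def)
  have inj_old: "inj_on (\<lambda>t. c' (w, t)) {t \<in> S. w \<in> t}" for w
    using inj[of w] c'_old by (auto simp: inj_on_def)
  have "own_colors c' (insert s S) w \<subseteq> C \<and>
        inj_on (\<lambda>t. c' (w, t)) {t \<in> insert s S. w \<in> t} \<and>
        own_colors c' (insert s S) w \<inter> neighbour_colors c' (insert s S) w = {} \<and>
        card (neighbour_colors c' (insert s S) w) \<le> p" for w
  proof (cases "w \<in> s")
    case False
    have "own_colors c' (insert s S) w = own_colors c S w"
      "neighbour_colors c' (insert s S) w = neighbour_colors c S w"
      unfolding own_colors_def[of c'] neighbour_colors_def[of c'] at_notin[OF False]
      by (fact own_old nb_old)+
    then show ?thesis using sub[of w] disj[of w] few[of w] inj_old[of w]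
      unfolding at_notin[OF False] by simp
  next
    case True
    have own: "own_colors c' (insert s S) w = insert (f w) (own_colors c S w)"
      unfolding own_colors_def[of c'] at_in[OF True] by (simp add: own_old c'_new)
    have nb: "neighbour_colors c' (insert s S) w = f ` (s - {w}) \<union> neighbour_colors c S w"
      unfolding neighbour_colors_def[of c'] at_in[OF True] by (simp add: nb_old c'_new)
    have new: "f w \<notin> own_colors c S w \<and>
        insert (f w) (own_colors c S w) \<inter> (f ` (s - {w}) \<union> neighbour_colors c S w) = {} \<and>
        card (f ` (s - {w}) \<union> neighbour_colors c S w) \<le> p"
    proof (cases "w = v")
      case True
      have "f ` (s - {v}) \<union> ?O \<subseteq> B" using fB B by blast
      moreover from this have "card (f ` (s - {v}) \<union> ?O) \<le> p"
        using card_mono[OF finB] B by metis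
      ultimately show ?thesis
        using True fv a B by blast
    next
      case False
      then have "{t \<in> S. w \<in> t} = {}" using v \<open>w \<in> s\<close> by blast
      then have "own_colors c S w = {}" "neighbour_colors c S w = {}"
        by (auto simp: own_colors_def neighbour_colors_def)
      moreover have "f w \<notin> f ` (s - {w})" using finj \<open>w \<in> s\<close> by (auto simp: inj_on_def)
      moreover have "card (f ` (s - {w})) \<le> p"
        using card_image_le[of "s - {w}" f] s \<open>w \<in> s\<close> by simp
      ultimately show ?thesis
        by simp
    qed
    have "f w \<notin> (\<lambda>t. c' (w, t)) ` {t \<in> S. w \<in> t}" using new own_old by simp
    then have "inj_on (\<lambda>t. c' (w, t)) {t \<in> insert s S. w \<in> t}"
      unfolding at_in[OF True] using inj_old[of w] s by (simp add: c'_new)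
    moreover have "insert (f w) (own_colors c S w) \<subseteq> C" using fC sub[of w] True by blast
    ultimately show ?thesis using new by (simp only: own nb)
  qed
  then show ?thesis unfolding palette_coloring_def by blast
qed

lemma running_intersection_palette_coloring:
  assumes "running_intersection S" "linear_hypergraph S" "{} \<notin> S"
    and "finite C" "card C = D + p"
    and "\<forall>s\<in>S. finite s \<and> card s \<le> Suc p" "\<forall>v. degree S v \<le> D"
  shows "\<exists>c. palette_coloring C p S c"
  using assms
proof (induction rule: running_intersection.induct)
  case empty
  then show ?case by (simp add: palette_coloring_def own_colors_def neighbour_colors_def)
next
  case (insert S s)
  have finS: "finite S" using insert.hyps running_intersection_finite by blast
  have "degree S v \<le> degree (insert s S) v" for v
    unfolding degree_def using finS by (intro card_mono) auto
  then have "\<forall>v. degree S v \<le> D" using insert.prems by (meson le_trans)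
  moreover have "linear_hypergraph S" using insert.prems by (simp add: linear_hypergraph_def)
  ultimately obtain c where c: "palette_coloring C p S c"
    using insert.IH insert.prems by auto
  have "s \<noteq> {}" "finite s" using insert.prems by auto
  have "card (s \<inter> \<Union>S) \<le> 1"
  proof (cases "S = {}")
    case False
    then obtain t where t: "t \<in> S" "s \<inter> \<Union>S \<subseteq> t" using insert.hyps by blast
    then have "card (s \<inter> \<Union>S) \<le> card (s \<inter> t)" using \<open>finite s\<close> by (intro card_mono) auto
    also have "\<dots> \<le> 1"
      using insert.prems(1) insert.hyps t unfolding linear_hypergraph_def by auto
    finally show ?thesis .
  qed simp
  \<comment> \<open>If \<open>s\<close> is disjoint from the earlier edges, every vertex of it serves as gluing vertex.\<close>
  then obtain v where v: "v \<in> s" "s \<inter> \<Union>S \<subseteq> {v}"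
  proof (cases "s \<inter> \<Union>S = {}")
    case True
    then show ?thesis using that \<open>s \<noteq> {}\<close> by blast
  next
    case False
    then have "card (s \<inter> \<Union>S) = 1"
      using \<open>card (s \<inter> \<Union>S) \<le> 1\<close> \<open>finite s\<close> by (simp add: le_Suc_eq)
    then show ?thesis using that by (metis card_1_singletonE Int_iff order_refl singletonI)
  qed
  show ?case
    using extend_palette_coloring[OF c insert.prems(3,4) finS _ insert.hyps(2) _ _ v]
      insert.prems(5,6) by simp
qed

section \<open>The incidence chromatic number\<close>

text \<open>The clique: all incidences at \<open>v\<close>, and all incidences of one edge \<open>s\<close> at \<open>v\<close>.  The two sets
  share only \<open>(v, s)\<close>.\<close>

lemma proper_incidence_coloring_lower_bound:
  assumes col: "proper_incidence_coloring X S m c" and S: "S \<subseteq> Pow X" "finite S"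
    and s: "s \<in> S" "v \<in> s" "finite s"
  shows "degree S v + card s - 1 \<le> m"
proof -
  let ?A = "Pair v ` {t \<in> S. v \<in> t}" and ?B = "(\<lambda>y. (y, s)) ` (s - {v})"
  have sub: "?A \<union> ?B \<subseteq> incidences X S" using S s by (auto simp: incidences_def)
  have adj: "adjacent i j" if "i \<in> ?A \<union> ?B" "j \<in> ?A \<union> ?B" "i \<noteq> j" for i j
    using that s by (auto simp: adjacent_def)
  have range: "c ` incidences X S \<subseteq> {1..m}"
    and proper: "\<And>i j. i \<in> incidences X S \<Longrightarrow> j \<in> incidences X S \<Longrightarrow> adjacent i j \<Longrightarrow> c i \<noteq> c j"
    using col unfolding proper_incidence_coloring_def by simp_all
  have inj: "inj_on c (?A \<union> ?B)"
  proof (intro inj_onI)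
    fix i j assume i: "i \<in> ?A \<union> ?B" and j: "j \<in> ?A \<union> ?B" and eq: "c i = c j"
    show "i = j" using proper[OF subsetD[OF sub i] subsetD[OF sub j]] adj[OF i j] eq by argo
  qed
  have "c ` (?A \<union> ?B) \<subseteq> {1..m}" using image_mono[OF sub] range by (rule subset_trans)
  then have "card (?A \<union> ?B) \<le> m" using card_inj_on_le[OF inj, of "{1..m}"] by simp
  moreover have "card (?A \<union> ?B) = card ?A + card ?B"
    using S s by (intro card_Un_disjoint) auto
  moreover have "card ?A = degree S v" by (simp add: degree_def card_image inj_on_def)
  moreover have "card ?B = card s - 1" using s by (simp add: card_image inj_on_def)
  ultimately show ?thesis by linarith
qed

theorem theorem1p2:
  fixes X :: "'a set" and S :: "'a set set"
  assumes "hypergraph X S"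
    and "alpha_acyclic S"
    and "linear_hypergraph S"
    and "S \<noteq> {}"
  shows "incidence_chromatic_number X S \<le> max_degree X S + rank S - 1 \<and>
    (\<forall>k. uniform k S \<longrightarrow> incidence_chromatic_number X S = max_degree X S + k - 1)"
proof -
  let ?D = "max_degree X S" and ?r = "rank S"
  let ?col = "\<lambda>k. \<exists>c. proper_incidence_coloring X S k c"
  have X: "finite X" "S \<subseteq> Pow X" "{} \<notin> S" using assms(1) by (auto simp: hypergraph_def)
  have finS: "finite S" using X by (auto intro: finite_subset)
  have edge_fin: "finite s" if "s \<in> S" for s using that X by (auto intro: finite_subset)
  obtain s0 where s0: "s0 \<in> S" "s0 \<noteq> {}" using assms(4) X by blast
  then have "X \<noteq> {}" using X by blast
  have card_le: "card s \<le> ?r" if "s \<in> S" for s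
    unfolding rank_def using that finS by simp
  have deg_le: "degree S v \<le> ?D" for v
  proof (cases "v \<in> X")
    case True
    then show ?thesis unfolding max_degree_def using X by simp
  next
    case False
    then have "{s \<in> S. v \<in> s} = {}" using X by blast
    then have "degree S v = 0" unfolding degree_def by (simp only: card.empty)
    then show ?thesis by simp
  qed
  have r: "?r \<ge> 1" using card_le[OF s0(1)] s0 edge_fin card_gt_0_iff[of s0] by auto
  obtain c where "palette_coloring {1..?D + (?r - 1)} (?r - 1) S c"
    using running_intersection_palette_coloring
      [OF alpha_acyclic_running_intersection[OF assms(2)] assms(3) X(3),
        of "{1..?D + (?r - 1)}" ?D "?r - 1"]
    using edge_fin card_le deg_le r by auto
  then have ex: "?col (?D + ?r - 1)" using palette_coloring_proper[of _ _ S c X] r by auto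
  then have upper: "incidence_chromatic_number X S \<le> ?D + ?r - 1"
    unfolding incidence_chromatic_number_def by (rule Least_le)
  have opt: "?col (incidence_chromatic_number X S)"
    unfolding incidence_chromatic_number_def by (rule LeastI[of ?col, OF ex])
  have "incidence_chromatic_number X S = ?D + k - 1" if "uniform k S" for k
  proof -
    have "card ` S = {k}" using that assms(4) by (auto simp: uniform_def)
    then have "?r = k" by (simp add: rank_def)
    have "?D \<in> degree S ` X" unfolding max_degree_def using X \<open>X \<noteq> {}\<close> by (intro Max_in) auto
    then obtain v where v: "degree S v = ?D" by auto
    obtain y where "y \<in> s0" using s0 by blast
    then have "0 < degree S y" using s0 finS by (auto simp: degree_def card_gt_0_iff)
    then have "0 < degree S v" using deg_le[of y] v by linarith
    then have "{s \<in> S. v \<in> s} \<noteq> {}" unfolding degree_def by (metis card.empty less_irrefl)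
    then obtain s where s: "s \<in> S" "v \<in> s" by blast
    have "card s = k" using that s by (simp add: uniform_def)
    moreover obtain c where "proper_incidence_coloring X S (incidence_chromatic_number X S) c"
      using opt by blast
    ultimately have "?D + k - 1 \<le> incidence_chromatic_number X S"
      using proper_incidence_coloring_lower_bound[OF _ X(2) finS s edge_fin[OF s(1)]] v by metis
    then show ?thesis using upper \<open>?r = k\<close> by simp
  qed
  then show ?thesis using upper by blast
qed

end
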